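(* Let $(A,\diamond,\ast)$ be a pre-$F$-manifold algebra, and set $x\cdot y=x\diamond y+y\diamond x$ and $[x,y]=x\ast y-y\ast x$ for $x,y\in A$. Then: (i) $(A,\cdot,[-,-])$ is an $F$-manifold algebra (called the sub-adjacent $F$-manifold algebra of $(A,\diamond,\ast)$ and denoted $A^c$). (ii) $(A;L,\mathfrak{L})$ is a representation of the sub-adjacent $F$-manifold algebra $A^c$, where $L,\mathfrak{L}:A\to\mathfrak{gl}(A)$ are given by $L_xy=x\ast y$ and $\mathfrak{L}_xy=x\diamond y$ for $x,y\in A$.
   Context: All vector spaces are finite dimensional over an algebraically closed field $\mathbb{K}$ of characteristic $0$. A Zinbiel algebra is a vector space with a bilinear product $\diamond$ such that $x\diamond(y\diamond z)=(y\diamond x)\diamond z+(x\diamond y)\diamond z$. A pre-Lie algebra is a vector space with a bilinear product $\ast$ such that $(x\ast y)\ast z-x\ast(y\ast z)=(y\ast x)\ast z-y\ast(x\ast z)$. A pre-$F$-manifold algebra is a triple $(A,\diamond,\ast)$ with $(A,\diamond)$ a Zinbiel algebra and $(A,\ast)$ a pre-Lie algebra such that, for all $x,y,z,w\in A$, $$F_1(x\cdot y,z,w)=x\diamond F_1(y,z,w)+y\diamond F_1(x,z,w),$$ $$(F_1(x,y,z)+F_1(x,z,y)+F_2(y,z,x))\diamond w=F_2(y,z,x\diamond w)-x\diamond F_2(y,z,w),$$ where $x\cdot y=x\diamond y+y\diamond x$, $[x,y]=x\ast y-y\ast x$, $F_1(x,y,z)=x\ast(y\diamond z)-y\diamond(x\ast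 z)-[x,y]\diamond z$ and $F_2(x,y,z)=x\diamond(y\ast z)+y\diamond(x\ast z)-(x\cdot y)\ast z$. An $F$-manifold algebra is a triple $(A,\cdot_A,[-,-]_A)$ where $(A,\cdot_A)$ is a commutative associative algebra and $(A,[-,-]_A)$ is a Lie algebra such that $P_{x\cdot_A y}(z,w)=x\cdot_A P_y(z,w)+y\cdot_A P_x(z,w)$ for all $x,y,z,w\in A$, where $P_x(y,z)=[x,y\cdot_A z]_A-[x,y]_A\cdot_A z-y\cdot_A[x,z]_A$. A representation of an $F$-manifold algebra $(A,\cdot_A,[-,-]_A)$ is a triple $(V;\rho,\mu)$ with $V$ a vector space and $\rho,\mu:A\to\mathfrak{gl}(V)$ linear, such that $(V;\rho)$ is a representation of the Lie algebra $(A,[-,-]_A)$, $(V;\mu)$ is a representation of the commutative associative algebra $(A,\cdot_A)$ (i.e. $\mu(x\cdot_A y)=\mu(x)\circ\mu(y)$), and for all $x,y,z\in A$ $$R_{\rho,\mu}(x\cdot_A y,z)=\mu(x)\circ R_{\rho,\mu}(y,z)+\mu(y)\circ R_{\rho,\mu}(x,z),$$ $$\mu(P_x(y,z))=S_{\rho,\mu}(y,z)\circ\mu(x)-\mu(x)\circ S_{\rho,\mu}(y,z),$$ where $R_{\rho,\mu}(x,y)=\rho(x)\circ\mu(y)-\mu(y)\circ\rho(x)-\mu([x,y]_A)$ and $S_{\rho,\mu}(x,y)=\mu(x)\circ\rho(y)+\mu(y)\circ\rho(x)-\rho(x\cdot_A y)$. *)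

theory Defs
  imports "HOL-Computational_Algebra.Polynomial" "HOL-Library.Function_Algebras"
begin

text \<open>
  The underlying space of an algebra is a whole type of class \<open>ab_group_add\<close> together with a scalar
  multiplication \<open>scale\<close>, as in \<open>HOL.Vector_Spaces\<close>.
\<close>

locale fd_space = vector_space scale
  for scale :: "'k::{alg_closed_field, field_char_0} \<Rightarrow> 'a::ab_group_add \<Rightarrow> 'a" +
  assumes finite_dimensional: "\<exists>B. finite_dimensional_vector_space scale B"

locale fd_algebra = fd_space scale
  for scale :: "'k::{alg_closed_field, field_char_0} \<Rightarrow> 'a::ab_group_add \<Rightarrow> 'a" +
  fixes prd :: "'a \<Rightarrow> 'a \<Rightarrow> 'a"
  assumes linear_right: "Vector_Spaces.linear scale scale (\<lambda>y. prd x y)"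
    and linear_left: "Vector_Spaces.linear scale scale (\<lambda>x. prd x y)"

locale zinbiel_algebra = fd_algebra scale zin
  for scale :: "'k::{alg_closed_field, field_char_0} \<Rightarrow> 'a::ab_group_add \<Rightarrow> 'a"
    and zin :: "'a \<Rightarrow> 'a \<Rightarrow> 'a" (infixl \<open>\<diamond>\<close> 70) +
  assumes zinbiel: "x \<diamond> (y \<diamond> z) = (y \<diamond> x) \<diamond> z + (x \<diamond> y) \<diamond> z"

locale pre_lie_algebra = fd_algebra scale pl
  for scale :: "'k::{alg_closed_field, field_char_0} \<Rightarrow> 'a::ab_group_add \<Rightarrow> 'a"
    and pl :: "'a \<Rightarrow> 'a \<Rightarrow> 'a" (infixl \<open>\<star>\<close> 70) +
  assumes pre_lie: "(x \<star> y) \<star> z - x \<star> (y \<star> z) = (y \<star> x) \<star> z - y \<star> (x \<star> z)"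

definition sub_mult :: "('a \<Rightarrow> 'a \<Rightarrow> 'a::ab_group_add) \<Rightarrow> 'a \<Rightarrow> 'a \<Rightarrow> 'a"
  where "sub_mult zin x y = zin x y + zin y x"

definition sub_bracket :: "('a \<Rightarrow> 'a \<Rightarrow> 'a::ab_group_add) \<Rightarrow> 'a \<Rightarrow> 'a \<Rightarrow> 'a"
  where "sub_bracket pl x y = pl x y - pl y x"

definition F1 ::
    "('a \<Rightarrow> 'a \<Rightarrow> 'a::ab_group_add) \<Rightarrow> ('a \<Rightarrow> 'a \<Rightarrow> 'a) \<Rightarrow> 'a \<Rightarrow> 'a \<Rightarrow> 'a \<Rightarrow> 'a"
  where "F1 zin pl x y z = pl x (zin y z) - zin y (pl x z) - zin (sub_bracket pl x y) z"

definition F2 ::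
    "('a \<Rightarrow> 'a \<Rightarrow> 'a::ab_group_add) \<Rightarrow> ('a \<Rightarrow> 'a \<Rightarrow> 'a) \<Rightarrow> 'a \<Rightarrow> 'a \<Rightarrow> 'a \<Rightarrow> 'a"
  where "F2 zin pl x y z = zin x (pl y z) + zin y (pl x z) - pl (sub_mult zin x y) z"

locale pre_F_manifold_algebra = zin: zinbiel_algebra scale zin + pl: pre_lie_algebra scale pl
  for scale :: "'k::{alg_closed_field, field_char_0} \<Rightarrow> 'a::ab_group_add \<Rightarrow> 'a"
    and zin :: "'a \<Rightarrow> 'a \<Rightarrow> 'a" (infixl \<open>\<diamond>\<close> 70)
    and pl :: "'a \<Rightarrow> 'a \<Rightarrow> 'a" (infixl \<open>\<star>\<close> 70) +
  assumes F1_derivation: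
      "F1 zin pl (sub_mult zin x y) z w = x \<diamond> F1 zin pl y z w + y \<diamond> F1 zin pl x z w"
    and F1_F2:
      "(F1 zin pl x y z + F1 zin pl x z y + F2 zin pl y z x) \<diamond> w
        = F2 zin pl y z (x \<diamond> w) - x \<diamond> F2 zin pl y z w"

text \<open>Commutative associative algebras are not required to have a unit.\<close>

locale comm_assoc_algebra = fd_algebra scale mul
  for scale :: "'k::{alg_closed_field, field_char_0} \<Rightarrow> 'a::ab_group_add \<Rightarrow> 'a"
    and mul :: "'a \<Rightarrow> 'a \<Rightarrow> 'a" +
  assumes mul_comm: "mul x y = mul y x"
    and mul_assoc: "mul (mul x y) z = mul x (mul y z)"

locale lie_algebra = fd_algebra scale brk
  for scale :: "'k::{alg_closed_field, field_char_0} \<Rightarrow> 'a::ab_group_add \<Rightarrow> 'a"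
    and brk :: "'a \<Rightarrow> 'a \<Rightarrow> 'a" +
  assumes alternating: "brk x x = 0"
    and jacobi: "brk x (brk y z) + brk y (brk z x) + brk z (brk x y) = 0"

definition P_map ::
    "('a \<Rightarrow> 'a \<Rightarrow> 'a::ab_group_add) \<Rightarrow> ('a \<Rightarrow> 'a \<Rightarrow> 'a) \<Rightarrow> 'a \<Rightarrow> 'a \<Rightarrow> 'a \<Rightarrow> 'a"
  where "P_map mul brk x y z = brk x (mul y z) - mul (brk x y) z - mul y (brk x z)"

locale F_manifold_algebra = mul: comm_assoc_algebra scale mul + brk: lie_algebra scale brk
  for scale :: "'k::{alg_closed_field, field_char_0} \<Rightarrow> 'a::ab_group_add \<Rightarrow> 'a"
    and mul :: "'a \<Rightarrow> 'a \<Rightarrow> 'a"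
    and brk :: "'a \<Rightarrow> 'a \<Rightarrow> 'a" +
  assumes hertling_manin:
    "P_map mul brk (mul x y) z w = mul x (P_map mul brk y z w) + mul y (P_map mul brk x z w)"

definition gl :: "('k::field \<Rightarrow> 'v::ab_group_add \<Rightarrow> 'v) \<Rightarrow> ('v \<Rightarrow> 'v) set"
  where "gl scale = {f. Vector_Spaces.linear scale scale f}"

text \<open>
  Sums, differences and scalar multiples of operators are pointwise
  (\<open>HOL-Library.Function_Algebras\<close>); composition is written \<open>\<circ>\<close>, which
  binds weaker than \<open>+\<close> and \<open>-\<close>, hence the explicit parentheses. A linear map into \<open>gl(V)\<close>
  is a linear map into the space of all functions on \<open>V\<close> whose values lie in \<open>gl(V)\<close>.
\<close>

locale gl_valued_map = A: fd_space scaleA + V: fd_space scaleV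
  for scaleA :: "'k::{alg_closed_field, field_char_0} \<Rightarrow> 'a::ab_group_add \<Rightarrow> 'a"
    and scaleV :: "'k \<Rightarrow> 'v::ab_group_add \<Rightarrow> 'v" +
  fixes \<rho> :: "'a \<Rightarrow> 'v \<Rightarrow> 'v"
  assumes in_gl: "\<rho> x \<in> gl scaleV"
    and linear_map: "Vector_Spaces.linear scaleA (\<lambda>c f v. scaleV c (f v)) \<rho>"

locale lie_rep = lie_algebra scaleA brk + gl_valued_map scaleA scaleV \<rho>
  for scaleA :: "'k::{alg_closed_field, field_char_0} \<Rightarrow> 'a::ab_group_add \<Rightarrow> 'a"
    and brk :: "'a \<Rightarrow> 'a \<Rightarrow> 'a"
    and scaleV :: "'k \<Rightarrow> 'v::ab_group_add \<Rightarrow> 'v"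
    and \<rho> :: "'a \<Rightarrow> 'v \<Rightarrow> 'v" +
  assumes rep_bracket: "\<rho> (brk x y) = (\<rho> x \<circ> \<rho> y) - (\<rho> y \<circ> \<rho> x)"

locale comm_assoc_rep = comm_assoc_algebra scaleA mul + gl_valued_map scaleA scaleV \<mu>
  for scaleA :: "'k::{alg_closed_field, field_char_0} \<Rightarrow> 'a::ab_group_add \<Rightarrow> 'a"
    and mul :: "'a \<Rightarrow> 'a \<Rightarrow> 'a"
    and scaleV :: "'k \<Rightarrow> 'v::ab_group_add \<Rightarrow> 'v"
    and \<mu> :: "'a \<Rightarrow> 'v \<Rightarrow> 'v" +
  assumes rep_mult: "\<mu> (mul x y) = \<mu> x \<circ> \<mu> y"

definition R_map ::
    "('a \<Rightarrow> 'a \<Rightarrow> 'a) \<Rightarrow> ('a \<Rightarrow> 'v \<Rightarrow> 'v::ab_group_add) \<Rightarrow> ('a \<Rightarrow> 'v \<Rightarrow> 'v)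
      \<Rightarrow> 'a \<Rightarrow> 'a \<Rightarrow> 'v \<Rightarrow> 'v"
  where "R_map brk \<rho> \<mu> x y = (\<rho> x \<circ> \<mu> y) - (\<mu> y \<circ> \<rho> x) - \<mu> (brk x y)"

definition S_map ::
    "('a \<Rightarrow> 'a \<Rightarrow> 'a) \<Rightarrow> ('a \<Rightarrow> 'v \<Rightarrow> 'v::ab_group_add) \<Rightarrow> ('a \<Rightarrow> 'v \<Rightarrow> 'v)
      \<Rightarrow> 'a \<Rightarrow> 'a \<Rightarrow> 'v \<Rightarrow> 'v"
  where "S_map mul \<rho> \<mu> x y = (\<mu> x \<circ> \<rho> y) + (\<mu> y \<circ> \<rho> x) - \<rho> (mul x y)"

locale F_manifold_rep =
    F_manifold_algebra scaleA mul brk + lie: lie_rep scaleA brk scaleV \<rho>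
      + assoc: comm_assoc_rep scaleA mul scaleV \<mu>
  for scaleA :: "'k::{alg_closed_field, field_char_0} \<Rightarrow> 'a::ab_group_add \<Rightarrow> 'a"
    and mul :: "'a \<Rightarrow> 'a \<Rightarrow> 'a"
    and brk :: "'a \<Rightarrow> 'a \<Rightarrow> 'a"
    and scaleV :: "'k \<Rightarrow> 'v::ab_group_add \<Rightarrow> 'v"
    and \<rho> :: "'a \<Rightarrow> 'v \<Rightarrow> 'v"
    and \<mu> :: "'a \<Rightarrow> 'v \<Rightarrow> 'v" +
  assumes R_derivation:
      "R_map brk \<rho> \<mu> (mul x y) z
        = (\<mu> x \<circ> R_map brk \<rho> \<mu> y z) + (\<mu> y \<circ> R_map brk \<rho> \<mu> x z)"
    and S_commutator:
      "\<mu> (P_map mul brk x y z)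
        = (S_map mul \<rho> \<mu> y z \<circ> \<mu> x) - (\<mu> x \<circ> S_map mul \<rho> \<mu> y z)"

end

theory Submission
  imports Defs
begin

text \<open>
  Both defects \<open>R\<close> and \<open>S\<close> of the left multiplications are \<open>F\<^sub>1\<close> and \<open>F\<^sub>2\<close>, and
  \<open>P\<^sub>x(y,z) = F\<^sub>1(x,y,z) + F\<^sub>1(x,z,y) + F\<^sub>2(y,z,x)\<close>. The representation identities are therefore the
  two axioms of a pre-F-manifold algebra. Substituting the first axiom and then the second into the
  formula for \<open>P\<close> at \<open>x \<cdot> y\<close> yields the Hertling-Manin relation.
\<close>

text \<open>Operations on the function space are pointwise, so linearity may be tested after
  evaluation at each \<open>v\<close>. This turns \<open>linear_left\<close> into linearity of
  \<open>prd\<close> as an operator-valued map.\<close>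

lemma linear_into_functions:
  fixes scaleA :: "'k::field \<Rightarrow> 'a::ab_group_add \<Rightarrow> 'a"
    and scaleV :: "'k \<Rightarrow> 'v::ab_group_add \<Rightarrow> 'v"
    and f :: "'a \<Rightarrow> 'b \<Rightarrow> 'v"
  assumes "vector_space scaleV"
    and lin: "\<And>v. Vector_Spaces.linear scaleA scaleV (\<lambda>x. f x v)"
  shows "Vector_Spaces.linear scaleA (\<lambda>c g v. scaleV c (g v)) f"
proof -
  interpret V: vector_space scaleV by fact
  interpret l: Vector_Spaces.linear scaleA scaleV "\<lambda>x. f x v" for v by (rule lin)
  show ?thesis
    by unfold_locales
      (auto simp: fun_eq_iff V.scale_right_distrib V.scale_left_distrib l.add l.scale)
qed

context fd_algebra
begin

lemma gl_valued_map_left_mult: "gl_valued_map scale scale prd"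
  by (intro gl_valued_map.intro gl_valued_map_axioms.intro fd_space_axioms linear_into_functions
      vector_space_axioms linear_left)
    (simp add: gl_def linear_right)

lemma right_add: "prd x (y + z) = prd x y + prd x z"
  and left_add: "prd (x + y) z = prd x z + prd y z"
  and right_diff: "prd x (y - z) = prd x y - prd x z"
  and left_diff: "prd (x - y) z = prd x z - prd y z"
proof -
  interpret r: Vector_Spaces.linear scale scale "\<lambda>y. prd x y" for x by (rule linear_right)
  interpret l: Vector_Spaces.linear scale scale "\<lambda>x. prd x y" for y by (rule linear_left)
  show "prd x (y + z) = prd x y + prd x z" "prd (x + y) z = prd x z + prd y z"
    "prd x (y - z) = prd x y - prd x z" "prd (x - y) z = prd x z - prd y z"
    by (rule r.add l.add r.diff l.diff)+
qed

lemma fd_algebra_sub_mult: "fd_algebra scale (sub_mult prd)"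
proof -
  interpret vector_space_pair scale scale by unfold_locales
  show ?thesis
    unfolding sub_mult_def
    by (intro fd_algebra.intro fd_space_axioms fd_algebra_axioms.intro linear_compose_add
        linear_right linear_left)
qed

lemma fd_algebra_sub_bracket: "fd_algebra scale (sub_bracket prd)"
proof -
  interpret vector_space_pair scale scale by unfold_locales
  show ?thesis
    unfolding sub_bracket_def
    by (intro fd_algebra.intro fd_space_axioms fd_algebra_axioms.intro linear_compose_sub
        linear_right linear_left)
qed

end

context zinbiel_algebra
begin

text \<open>By left additivity, the two terms on the right of the Zinbiel identity merge. The result
  drives both associativity of \<open>sub_mult zin\<close> and the action by left
  multiplication.\<close>

lemma sub_mult_zin: "sub_mult zin x y \<diamond> z = x \<diamond> (y \<diamond> z)"
  by (simp add: sub_mult_def left_add zinbiel add.commute)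

lemma zin_left_commute: "x \<diamond> (y \<diamond> z) = y \<diamond> (x \<diamond> z)"
  by (simp add: zinbiel[of x y] zinbiel[of y x] add.commute)

lemma comm_assoc_algebra_sub_mult: "comm_assoc_algebra scale (sub_mult zin)"
proof -
  interpret m: fd_algebra scale "sub_mult zin" by (rule fd_algebra_sub_mult)
  show ?thesis
  proof unfold_locales
    show "sub_mult zin x y = sub_mult zin y x" for x y
      by (simp add: sub_mult_def add.commute)
    show "sub_mult zin (sub_mult zin x y) z = sub_mult zin x (sub_mult zin y z)" for x y z
    proof -
      have "sub_mult zin (sub_mult zin x y) z = x \<diamond> (y \<diamond> z) + (z \<diamond> (x \<diamond> y) + z \<diamond> (y \<diamond> x))"
        unfolding sub_mult_def[of _ _ z] sub_mult_zin by (simp add: sub_mult_def right_add)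
      \<comment> \<open>Moving \<open>z\<close> inwards makes every summand a right-nested product,
        with the sum symmetric in \<open>y\<close> and \<open>z\<close> up to left
        commutation.\<close>
      also have "\<dots> = x \<diamond> (y \<diamond> z) + x \<diamond> (z \<diamond> y) + y \<diamond> (z \<diamond> x)"
        by (simp add: zin_left_commute[of z] add.assoc)
      also have "\<dots> = sub_mult zin x (sub_mult zin y z)"
        unfolding sub_mult_def[of _ x] sub_mult_zin by (simp add: sub_mult_def right_add)
      finally show ?thesis .
    qed
  qed
qed

lemma comm_assoc_rep_left_mult: "comm_assoc_rep scale (sub_mult zin) scale zin"
  by (intro comm_assoc_rep.intro comm_assoc_algebra_sub_mult gl_valued_map_left_mult
      comm_assoc_rep_axioms.intro) (simp add: fun_eq_iff sub_mult_zin)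

end

context pre_lie_algebra
begin

text \<open>This is symmetry of the associator in its first two arguments, rearranged.\<close>

lemma sub_bracket_pl: "sub_bracket pl x y \<star> z = x \<star> (y \<star> z) - y \<star> (x \<star> z)"
  using pre_lie[of x y z] by (simp add: sub_bracket_def left_diff algebra_simps)

lemma lie_algebra_sub_bracket: "lie_algebra scale (sub_bracket pl)"
proof -
  interpret b: fd_algebra scale "sub_bracket pl" by (rule fd_algebra_sub_bracket)
  \<comment> \<open>In the Jacobi sum, each of the six right-nested products of \<open>x\<close>,
    \<open>y\<close>, \<open>z\<close> then occurs once with each sign.\<close>
  have expand: "sub_bracket pl x (sub_bracket pl y z)
      = x \<star> (y \<star> z) - x \<star> (z \<star> y) - (y \<star> (z \<star> x) - z \<star> (y \<star> x))" for x y z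
    unfolding sub_bracket_def[of _ x] sub_bracket_pl by (simp add: sub_bracket_def right_diff)
  show ?thesis
    by unfold_locales (simp add: sub_bracket_def, simp add: expand)
qed

lemma lie_rep_left_mult: "lie_rep scale (sub_bracket pl) scale pl"
  by (intro lie_rep.intro lie_algebra_sub_bracket gl_valued_map_left_mult
      lie_rep_axioms.intro) (simp add: fun_eq_iff sub_bracket_pl)

end

context pre_F_manifold_algebra
begin

text \<open>The two \<open>F1\<close> terms leave one-sided products such as
  \<open>y \<diamond> (x \<star> z)\<close>; \<open>F2\<close> supplies the opposite products, such
  as \<open>y \<diamond> (z \<star> x)\<close>, that complete the brackets.\<close>

lemma P_map_eq:
  "P_map (sub_mult zin) (sub_bracket pl) x y z = F1 zin pl x y z + F1 zin pl x z y + F2 zin pl y z x"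
  by (simp add: P_map_def F1_def F2_def sub_mult_def sub_bracket_def zin.right_add zin.left_add
      zin.right_diff zin.left_diff pl.right_add pl.left_add algebra_simps)

lemma R_map_eq: "R_map (sub_bracket pl) pl zin x y = F1 zin pl x y"
  by (simp add: R_map_def F1_def fun_eq_iff)

lemma S_map_eq: "S_map (sub_mult zin) pl zin x y = F2 zin pl x y"
  by (simp add: S_map_def F2_def fun_eq_iff)

lemma F2_zin:
  "F2 zin pl y z (x \<diamond> w)
    = P_map (sub_mult zin) (sub_bracket pl) x y z \<diamond> w + x \<diamond> F2 zin pl y z w"
  by (simp add: P_map_eq F1_F2)

lemma F2_add: "F2 zin pl x y (v + w) = F2 zin pl x y v + F2 zin pl x y w"
  by (simp add: F2_def pl.right_add zin.right_add)

lemma F_manifold_algebra_sub_adjacent: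
  "F_manifold_algebra scale (sub_mult zin) (sub_bracket pl)"
proof (intro F_manifold_algebra.intro zin.comm_assoc_algebra_sub_mult pl.lie_algebra_sub_bracket
    F_manifold_algebra_axioms.intro)
  fix x y z w
  let ?P = "P_map (sub_mult zin) (sub_bracket pl)"
  have "?P (sub_mult zin x y) z w
      = x \<diamond> F1 zin pl y z w + y \<diamond> F1 zin pl x z w + (x \<diamond> F1 zin pl y w z + y \<diamond> F1 zin pl x w z)
        + (F2 zin pl z w (x \<diamond> y) + F2 zin pl z w (y \<diamond> x))"
    \<comment> \<open>Splitting \<open>F2\<close> at the symmetrised product into both orders makes
      each half accessible to \<open>F2_zin\<close>.\<close>
    by (simp only: P_map_eq F1_derivation F2_add[symmetric] sub_mult_def[of zin x y, symmetric])
  also have "\<dots> = x \<diamond> ?P y z w + ?P y z w \<diamond> x + (y \<diamond> ?P x z w + ?P x z w \<diamond> y)"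
    \<comment> \<open>The term \<open>x \<diamond> F2 zin pl z w y\<close> joins the two
      \<open>F1\<close> terms under \<open>x\<close> to form \<open>x \<diamond> ?P y z w\<close>;
      likewise with \<open>x\<close> and \<open>y\<close> exchanged.\<close>
    unfolding F2_zin by (simp add: P_map_eq zin.right_add algebra_simps)
  finally show "?P (sub_mult zin x y) z w
      = sub_mult zin x (?P y z w) + sub_mult zin y (?P x z w)"
    by (simp only: sub_mult_def[of zin x "?P y z w"] sub_mult_def[of zin y "?P x z w"])
qed

lemma F_manifold_rep_left_mult:
  "F_manifold_rep scale (sub_mult zin) (sub_bracket pl) scale pl zin"
  by (intro F_manifold_rep.intro F_manifold_algebra_sub_adjacent pl.lie_rep_left_mult
      zin.comm_assoc_rep_left_mult F_manifold_rep_axioms.intro)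
    \<comment> \<open>Evaluated at a vector, the commutator condition is \<open>F2_zin\<close> with
      its \<open>P_map\<close> term isolated.\<close>
    (simp_all add: fun_eq_iff R_map_eq S_map_eq F1_derivation F2_zin)

end

theorem theorem4p13:
  fixes scale :: "'k::{alg_closed_field, field_char_0} \<Rightarrow> 'a::ab_group_add \<Rightarrow> 'a"
    and zin :: "'a \<Rightarrow> 'a \<Rightarrow> 'a" (infixl \<open>\<diamond>\<close> 70)
    and pl :: "'a \<Rightarrow> 'a \<Rightarrow> 'a" (infixl \<open>\<star>\<close> 70)
  assumes "pre_F_manifold_algebra scale zin pl"
  shows "F_manifold_algebra scale (sub_mult zin) (sub_bracket pl)
    \<and> F_manifold_rep scale (sub_mult zin) (sub_bracket pl) scale
        (\<lambda>x y. x \<star> y) (\<lambda>x y. x \<diamond> y)"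
  using pre_F_manifold_algebra.F_manifold_algebra_sub_adjacent[OF assms]
    pre_F_manifold_algebra.F_manifold_rep_left_mult[OF assms] by blast

end
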